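(* Let $VB_n$ be the virtual braid group on $n$ strands and $VB_n'=[VB_n,VB_n]$ its commutator subgroup. Then $VB_3'$ is infinitely generated (i.e. not finitely generated), and for every $n\ge 4$ the group $VB_n'$ can be generated by $2n-3$ elements.
   Context: The virtual braid group $VB_n$ is the group with generators $\sigma_1,\dots,\sigma_{n-1},\rho_1,\dots,\rho_{n-1}$ and defining relations: $\sigma_i\sigma_j=\sigma_j\sigma_i$ for $|i-j|\ge 2$; $\sigma_i\sigma_{i+1}\sigma_i=\sigma_{i+1}\sigma_i\sigma_{i+1}$ for $1\le i\le n-2$; $\rho_i^2=1$ for $1\le i\le n-1$; $\rho_i\rho_j=\rho_j\rho_i$ for $|i-j|\ge 2$; $\rho_i\rho_{i+1}\rho_i=\rho_{i+1}\rho_i\rho_{i+1}$ for $1\le i\le n-2$; $\sigma_i\rho_j=\rho_j\sigma_i$ for $|i-j|\ge 2$; $\rho_i\rho_{i+1}\sigma_i=\sigma_{i+1}\rho_i\rho_{i+1}$ for $1\le i\le n-2$. *)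

theory Defs
  imports "HOL-Algebra.Generated_Groups"
begin

text \<open>
  Words in letters \<open>x\<close> and \<open>x\<^sup>-\<^sup>1\<close>: the pair \<open>(x, True)\<close> stands for \<open>x\<close> and
  \<open>(x, False)\<close> for \<open>x\<^sup>-\<^sup>1\<close>.
\<close>

type_synonym 'a word = "('a \<times> bool) list"

abbreviation words :: "'a set \<Rightarrow> 'a word set" where
  "words X \<equiv> lists (X \<times> UNIV)"

text \<open>
  The congruence on words over \<open>X\<close> generated by free cancellation and by the relations
  \<open>r = s\<close> with \<open>(r, s) \<in> R\<close>; its classes form the group with presentation \<open>\<langle>X | R\<rangle>\<close>.
\<close>

inductive_set pres_cong :: "'a set \<Rightarrow> ('a word \<times> 'a word) set \<Rightarrow> ('a word \<times> 'a word) set"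
  for X R where
  refl: "w \<in> words X \<Longrightarrow> (w, w) \<in> pres_cong X R"
| sym: "(v, w) \<in> pres_cong X R \<Longrightarrow> (w, v) \<in> pres_cong X R"
| trans: "(u, v) \<in> pres_cong X R \<Longrightarrow> (v, w) \<in> pres_cong X R \<Longrightarrow> (u, w) \<in> pres_cong X R"
| cancel: "u \<in> words X \<Longrightarrow> v \<in> words X \<Longrightarrow> x \<in> X \<Longrightarrow>
    (u @ [(x, b), (x, \<not> b)] @ v, u @ v) \<in> pres_cong X R"
| rel: "u \<in> words X \<Longrightarrow> v \<in> words X \<Longrightarrow> r \<in> words X \<Longrightarrow> s \<in> words X \<Longrightarrow> (r, s) \<in> R \<Longrightarrow>
    (u @ r @ v, u @ s @ v) \<in> pres_cong X R"

definition presented_group :: "'a set \<Rightarrow> ('a word \<times> 'a word) set \<Rightarrow> 'a word set monoid" where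
  "presented_group X R =
    \<lparr>carrier = words X // pres_cong X R,
     mult = (\<lambda>A B. \<Union>a\<in>A. \<Union>b\<in>B. pres_cong X R `` {a @ b}),
     one = pres_cong X R `` {[]}\<rparr>"

lemma pres_cong_words:
  assumes "(v, w) \<in> pres_cong X R"
  shows "v \<in> words X \<and> w \<in> words X"
  using assms by induction auto

lemma equiv_pres_cong: "equiv (words X) (pres_cong X R)"
  by (auto simp: refl_on_def intro!: equivI symI transI
      dest: pres_cong_words pres_cong.sym intro: pres_cong.refl pres_cong.trans)

lemma pres_cong_context:
  assumes "(v, w) \<in> pres_cong X R" "p \<in> words X" "q \<in> words X"
  shows "(p @ v @ q, p @ w @ q) \<in> pres_cong X R"
  using assms
proof (induction)
  case (refl w)
  then show ?case by (intro pres_cong.refl) simp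
next
  case (sym v w)
  then show ?case by (blast intro: pres_cong.sym)
next
  case (trans u v w)
  then show ?case by (blast intro: pres_cong.trans)
next
  case (cancel u v x b)
  then show ?case using pres_cong.cancel[of "p @ u" X "v @ q" x b R] by simp
next
  case (rel u v r s)
  then show ?case using pres_cong.rel[of "p @ u" X "v @ q" r s R] by simp
qed

lemma pres_cong_append:
  assumes "(a, a') \<in> pres_cong X R" "(b, b') \<in> pres_cong X R"
  shows "(a @ b, a' @ b') \<in> pres_cong X R"
proof -
  have "(a @ b, a' @ b) \<in> pres_cong X R"
    using pres_cong_context[OF assms(1), of "[]" b] pres_cong_words[OF assms(2)] by simp
  moreover have "(a' @ b, a' @ b') \<in> pres_cong X R"
    using pres_cong_context[OF assms(2), of a' "[]"] pres_cong_words[OF assms(1)] by simp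
  ultimately show ?thesis by (rule pres_cong.trans)
qed

lemma presented_group_mult:
  assumes "a \<in> words X" "b \<in> words X"
  shows "(pres_cong X R `` {a}) \<otimes>\<^bsub>presented_group X R\<^esub> (pres_cong X R `` {b})
    = pres_cong X R `` {a @ b}"
proof -
  have "congruent2 (pres_cong X R) (pres_cong X R) (\<lambda>a b. pres_cong X R `` {a @ b})"
    by (intro congruent2I' equiv_class_eq[OF equiv_pres_cong] pres_cong_append)
  from UN_equiv_class2[OF equiv_pres_cong equiv_pres_cong this assms] show ?thesis
    by (simp add: presented_group_def)
qed

definition inv_word :: "'a word \<Rightarrow> 'a word" where
  "inv_word w = rev (map (\<lambda>(x, b). (x, \<not> b)) w)"

lemma inv_word_words: "w \<in> words X \<Longrightarrow> inv_word w \<in> words X"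
  by (induction w) (auto simp: inv_word_def)

lemma inv_word_append_cong:
  assumes "w \<in> words X"
  shows "(inv_word w @ w, []) \<in> pres_cong X R"
  using assms
proof (induction w rule: list.induct)
  case Nil
  then show ?case by (simp add: inv_word_def pres_cong.refl)
next
  case (Cons a w)
  obtain x b where a: "a = (x, b)" by fastforce
  have w: "w \<in> words X" and x: "x \<in> X" using Cons.prems by (auto simp: a)
  have "(inv_word w @ [(x, \<not> b), (x, \<not> \<not> b)] @ w, inv_word w @ w) \<in> pres_cong X R"
    by (rule pres_cong.cancel[OF inv_word_words[OF w] w x])
  from pres_cong.trans[OF this Cons.IH[OF w]] show ?case
    by (simp add: a inv_word_def)
qed

lemma group_presented_group: "group (presented_group X R)"
proof -
  let ?G = "presented_group X R" and ?c = "\<lambda>w. pres_cong X R `` {w}"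
  have car: "\<exists>w\<in>words X. A = ?c w" if "A \<in> carrier ?G" for A
    using that by (auto simp: presented_group_def elim: quotientE)
  have cl: "?c w \<in> carrier ?G" if "w \<in> words X" for w
    using that by (simp add: presented_group_def quotientI)
  have one: "\<one>\<^bsub>?G\<^esub> = ?c []" by (simp add: presented_group_def)
  show ?thesis
  proof (rule groupI)
    fix A B assume "A \<in> carrier ?G" "B \<in> carrier ?G"
    then obtain a b where "a \<in> words X" "b \<in> words X" "A = ?c a" "B = ?c b"
      using car by meson
    then show "A \<otimes>\<^bsub>?G\<^esub> B \<in> carrier ?G"
      by (metis presented_group_mult cl append_in_lists_conv)
  next
    show "\<one>\<^bsub>?G\<^esub> \<in> carrier ?G" by (simp add: one cl)
  next
    fix A B C assume "A \<in> carrier ?G" "B \<in> carrier ?G" "C \<in> carrier ?G"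
    then obtain a b c where "a \<in> words X" "b \<in> words X" "c \<in> words X"
      "A = ?c a" "B = ?c b" "C = ?c c"
      using car by meson
    then show "A \<otimes>\<^bsub>?G\<^esub> B \<otimes>\<^bsub>?G\<^esub> C = A \<otimes>\<^bsub>?G\<^esub> (B \<otimes>\<^bsub>?G\<^esub> C)"
      by (simp add: presented_group_mult)
  next
    fix A assume "A \<in> carrier ?G"
    then obtain a where a: "a \<in> words X" "A = ?c a" using car by meson
    show "\<one>\<^bsub>?G\<^esub> \<otimes>\<^bsub>?G\<^esub> A = A"
      using a by (simp add: one presented_group_mult)
    have "?c (inv_word a) \<otimes>\<^bsub>?G\<^esub> A = ?c (inv_word a @ a)"
      using a by (simp add: presented_group_mult inv_word_words)
    also have "\<dots> = \<one>\<^bsub>?G\<^esub>"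
      using equiv_class_eq[OF equiv_pres_cong inv_word_append_cong[OF a(1)]] by (simp add: one)
    finally show "\<exists>B\<in>carrier ?G. B \<otimes>\<^bsub>?G\<^esub> A = \<one>\<^bsub>?G\<^esub>"
      using cl[OF inv_word_words[OF a(1)]] by blast
  qed
qed

datatype vb_gen = SigmaGen nat | RhoGen nat

definition vb_gens :: "nat \<Rightarrow> vb_gen set" where
  "vb_gens n = SigmaGen ` {1..n - 1} \<union> RhoGen ` {1..n - 1}"

definition sg :: "nat \<Rightarrow> vb_gen word" where
  "sg i = [(SigmaGen i, True)]"

definition rh :: "nat \<Rightarrow> vb_gen word" where
  "rh i = [(RhoGen i, True)]"

abbreviation far :: "nat \<Rightarrow> nat \<Rightarrow> bool" where
  "far i j \<equiv> \<bar>int i - int j\<bar> \<ge> 2"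

definition vb_rels :: "nat \<Rightarrow> (vb_gen word \<times> vb_gen word) set" where
  "vb_rels n =
     {(sg i @ sg j, sg j @ sg i) | i j. i \<in> {1..n - 1} \<and> j \<in> {1..n - 1} \<and> far i j}
   \<union> {(sg i @ sg (i + 1) @ sg i, sg (i + 1) @ sg i @ sg (i + 1)) | i. i \<in> {1..n - 2}}
   \<union> {(rh i @ rh i, []) | i. i \<in> {1..n - 1}}
   \<union> {(rh i @ rh j, rh j @ rh i) | i j. i \<in> {1..n - 1} \<and> j \<in> {1..n - 1} \<and> far i j}
   \<union> {(rh i @ rh (i + 1) @ rh i, rh (i + 1) @ rh i @ rh (i + 1)) | i. i \<in> {1..n - 2}}
   \<union> {(sg i @ rh j, rh j @ sg i) | i j. i \<in> {1..n - 1} \<and> j \<in> {1..n - 1} \<and> far i j}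
   \<union> {(rh i @ rh (i + 1) @ sg i, sg (i + 1) @ rh i @ rh (i + 1)) | i. i \<in> {1..n - 2}}"

definition VB :: "nat \<Rightarrow> vb_gen word set monoid" where
  "VB n = presented_group (vb_gens n) (vb_rels n)"

lemma group_VB: "group (VB n)"
  by (simp add: VB_def group_presented_group)

text \<open>The side condition of \<open>rel\<close> in \<open>pres_cong\<close> discards no defining relation.\<close>

lemma vb_rels_words: "vb_rels n \<subseteq> words (vb_gens n) \<times> words (vb_gens n)"
  unfolding vb_rels_def vb_gens_def sg_def rh_def by auto

end

theory Submission
  imports Complex_Main Defs
begin

text \<open>
  Sending every \<open>\<sigma>\<^sub>i\<close> to \<open>x \<mapsto> x / 2\<close> and every \<open>\<rho>\<^sub>i\<close> to \<open>x \<mapsto> 1 - x\<close> maps \<open>VB\<^sub>3\<close> to the affine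
  group of the rationals; the far relations, which would force these two maps to commute, are void
  for \<open>n = 3\<close>. The derived subgroup goes to translations, among them those by \<open>2\<^sup>-\<^sup>k - 1\<close> for every
  \<open>k\<close>, whereas finitely many translations have a common denominator.

  For \<open>n \<ge> 4\<close> put \<open>v\<^sub>j = \<rho>\<^sub>j \<rho>\<^sub>1\<close>, \<open>u = \<sigma>\<^sub>2 \<sigma>\<^sub>1\<^sup>-\<^sup>1\<close>, \<open>p = \<sigma>\<^sub>1 u \<sigma>\<^sub>1\<^sup>-\<^sup>1\<close> and \<open>c = [\<sigma>\<^sub>1, \<rho>\<^sub>1]\<close>. The
  \<open>n + 1 \<le> 2 n - 3\<close> elements \<open>v\<^sub>2, \<dots>, v\<^bsub>n-1\<^esub>, u, p, c\<close> of \<open>VB\<^sub>n'\<close> generate a subgroup \<open>H\<close> that is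
  normalized by \<open>\<sigma>\<^sub>1\<close> and \<open>\<rho>\<^sub>1\<close>. Since \<open>\<sigma>\<^sub>1\<close>, \<open>\<rho>\<^sub>1\<close> and \<open>H\<close> generate \<open>VB\<^sub>n\<close> and \<open>\<sigma>\<^sub>1\<close>, \<open>\<rho>\<^sub>1\<close> commute
  modulo \<open>H\<close>, the quotient by \<open>H\<close> is abelian. The crucial point is that \<open>y = \<sigma>\<^sub>3 \<sigma>\<^sub>1\<^sup>-\<^sup>1\<close> lies in \<open>H\<close>:
  as \<open>\<sigma>\<^sub>3\<close> commutes with \<open>c\<close>, conjugating \<open>c\<close> by \<open>\<sigma>\<^sub>1\<close> amounts to conjugating it by \<open>y\<^sup>-\<^sup>1\<close>.
\<close>

section \<open>Presented groups\<close>

definition presented_gen :: "'a set \<Rightarrow> ('a word \<times> 'a word) set \<Rightarrow> 'a \<Rightarrow> 'a word set" where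
  "presented_gen X R x = pres_cong X R `` {[(x, True)]}"

lemma presented_group_class_closed:
  "w \<in> words X \<Longrightarrow> pres_cong X R `` {w} \<in> carrier (presented_group X R)"
  by (simp add: presented_group_def quotientI)

lemma presented_group_carrierE:
  assumes "A \<in> carrier (presented_group X R)"
  obtains w where "w \<in> words X" "A = pres_cong X R `` {w}"
proof -
  have "A \<in> words X // pres_cong X R" using assms by (simp add: presented_group_def)
  then obtain w where "A = pres_cong X R `` {w}" "w \<in> words X" by (rule quotientE)
  then show ?thesis using that by blast
qed

lemma presented_gen_closed: "x \<in> X \<Longrightarrow> presented_gen X R x \<in> carrier (presented_group X R)"
  by (simp add: presented_gen_def presented_group_class_closed)

lemma presented_group_one: "\<one>\<^bsub>presented_group X R\<^esub> = pres_cong X R `` {[]}"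
  by (simp add: presented_group_def)

lemma presented_gen_inv:
  assumes "x \<in> X"
  shows "inv\<^bsub>presented_group X R\<^esub> (presented_gen X R x) = pres_cong X R `` {[(x, False)]}"
proof -
  interpret group "presented_group X R" by (rule group_presented_group)
  have "([(x, False), (x, True)], []) \<in> pres_cong X R"
    using pres_cong.cancel[of "[]" X "[]" x False R] assms by simp
  then have "pres_cong X R `` {[(x, False)]} \<otimes>\<^bsub>presented_group X R\<^esub> presented_gen X R x
      = \<one>\<^bsub>presented_group X R\<^esub>"
    using assms equiv_class_eq[OF equiv_pres_cong]
    by (simp add: presented_gen_def presented_group_mult presented_group_one)
  then show ?thesis
    using assms by (intro inv_equality presented_gen_closed presented_group_class_closed) auto
qed

lemma presented_group_generate:
  "generate (presented_group X R) (presented_gen X R ` X) = carrier (presented_group X R)"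
proof -
  interpret group "presented_group X R" by (rule group_presented_group)
  let ?H = "generate (presented_group X R) (presented_gen X R ` X)"
  have "pres_cong X R `` {w} \<in> ?H" if "w \<in> words X" for w
    using that
  proof (induction w)
    case Nil
    then show ?case using generate.one[of "presented_group X R"] by (simp add: presented_group_one)
  next
    case (Cons a w)
    obtain x b where a: "a = (x, b)" by fastforce
    have x: "x \<in> X" using Cons a by auto
    have "presented_gen X R x \<in> presented_gen X R ` X" using x by blast
    from generate.incl[OF this] generate.inv[OF this, of "presented_group X R"]
    have "pres_cong X R `` {[a]} \<in> ?H"
      using x unfolding presented_gen_inv[OF x] by (cases b) (auto simp: a presented_gen_def)
    from generate.eng[OF this Cons.IH] show ?case
      using Cons by (simp add: presented_group_mult)
  qed
  moreover have "?H \<subseteq> carrier (presented_group X R)"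
    by (intro generate_incl) (auto intro: presented_gen_closed)
  ultimately show ?thesis by (auto elim!: presented_group_carrierE)
qed

section \<open>Homomorphisms out of a presented group\<close>

primrec eval_word :: "('b, 'c) monoid_scheme \<Rightarrow> ('a \<Rightarrow> 'b) \<Rightarrow> 'a word \<Rightarrow> 'b" where
  "eval_word Q f [] = \<one>\<^bsub>Q\<^esub>"
| "eval_word Q f (a # w) =
    (if snd a then f (fst a) else inv\<^bsub>Q\<^esub> (f (fst a))) \<otimes>\<^bsub>Q\<^esub> eval_word Q f w"

context
  fixes Q :: "('b, 'c) monoid_scheme" and f :: "'a \<Rightarrow> 'b" and X :: "'a set"
  assumes Q: "group Q" and f: "f \<in> X \<rightarrow> carrier Q"
begin

interpretation group Q by (rule Q)

lemma eval_word_closed: "w \<in> words X \<Longrightarrow> eval_word Q f w \<in> carrier Q"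
  using f by (induction w) (auto simp: Pi_iff)

lemma eval_word_append:
  "v \<in> words X \<Longrightarrow> w \<in> words X \<Longrightarrow> eval_word Q f (v @ w) = eval_word Q f v \<otimes>\<^bsub>Q\<^esub> eval_word Q f w"
proof (induction v)
  case (Cons a v)
  then have "eval_word Q f v \<in> carrier Q" "eval_word Q f w \<in> carrier Q" "f (fst a) \<in> carrier Q"
    using f eval_word_closed by auto
  then show ?case using Cons by (simp add: m_assoc)
qed (simp add: eval_word_closed)

lemma eval_word_cong:
  assumes R: "\<And>r s. (r, s) \<in> R \<Longrightarrow> eval_word Q f r = eval_word Q f s"
    and vw: "(v, w) \<in> pres_cong X R"
  shows "eval_word Q f v = eval_word Q f w"
  using vw
proof induction
  case (cancel u v x b)
  then have "eval_word Q f u \<in> carrier Q" "eval_word Q f v \<in> carrier Q" "f x \<in> carrier Q"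
    using f eval_word_closed by auto
  then show ?case using cancel by (simp add: eval_word_append m_assoc[symmetric]) (simp add: m_assoc)
next
  case (rel u v r s)
  then show ?case using R[of r s] by (simp add: eval_word_append)
qed auto

text \<open>Universal property of a presentation. By \<open>eval_word_cong\<close> evaluation is
  constant on each congruence class, so the image of a class is a singleton and
  \<open>the_elem\<close> extracts its value.\<close>

lemma presented_group_hom:
  assumes R: "\<And>r s. (r, s) \<in> R \<Longrightarrow> eval_word Q f r = eval_word Q f s"
  obtains h where "h \<in> hom (presented_group X R) Q"
    "\<And>x. x \<in> X \<Longrightarrow> h (presented_gen X R x) = f x"
proof
  define h where "h A = the_elem (eval_word Q f ` A)" for A
  have h: "h (pres_cong X R `` {w}) = eval_word Q f w" if "w \<in> words X" for w
  proof -
    have "eval_word Q f v = eval_word Q f w" if "(w, v) \<in> pres_cong X R" for v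
      using eval_word_cong[OF R that] by simp
    moreover have "(w, w) \<in> pres_cong X R" by (rule pres_cong.refl[OF that])
    ultimately have "eval_word Q f ` (pres_cong X R `` {w}) = {eval_word Q f w}" by blast
    then show ?thesis by (simp add: h_def)
  qed
  show "h \<in> hom (presented_group X R) Q"
  proof (rule homI)
    fix A assume "A \<in> carrier (presented_group X R)"
    then show "h A \<in> carrier Q"
      by (rule presented_group_carrierE) (simp only: h eval_word_closed)
  next
    fix A B assume "A \<in> carrier (presented_group X R)" "B \<in> carrier (presented_group X R)"
    then obtain a b where "a \<in> words X" "A = pres_cong X R `` {a}"
      "b \<in> words X" "B = pres_cong X R `` {b}"
      by (elim presented_group_carrierE) (rule that)
    then show "h (A \<otimes>\<^bsub>presented_group X R\<^esub> B) = h A \<otimes>\<^bsub>Q\<^esub> h B"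
      by (simp only: presented_group_mult h eval_word_append append_in_lists_conv simp_thms)
  qed
  show "h (presented_gen X R x) = f x" if "x \<in> X" for x
    using that f by (auto simp: presented_gen_def h Pi_iff)
qed

end

section \<open>The derived subgroup on three strands\<close>

text \<open>The pair \<open>(a, b)\<close> stands for the map \<open>x \<mapsto> a x + b\<close>.\<close>

definition affine_group :: "(rat \<times> rat) monoid" where
  "affine_group = \<lparr>carrier = {(a, b). a \<noteq> 0},
     mult = (\<lambda>(a, b) (c, d). (a * c, a * d + b)), one = (1, 0)\<rparr>"

lemma affine_group_simps [simp]:
  "(a, b) \<in> carrier affine_group \<longleftrightarrow> a \<noteq> 0"
  "(a, b) \<otimes>\<^bsub>affine_group\<^esub> (c, d) = (a * c, a * d + b)"
  "\<one>\<^bsub>affine_group\<^esub> = (1, 0)"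
  by (simp_all add: affine_group_def)

lemma group_affine_group: "group affine_group"
proof (rule groupI)
  fix x assume "x \<in> carrier affine_group"
  then obtain a b where "x = (a, b)" "a \<noteq> 0" by (cases x) auto
  then show "\<exists>y\<in>carrier affine_group. y \<otimes>\<^bsub>affine_group\<^esub> x = \<one>\<^bsub>affine_group\<^esub>"
    by (intro bexI[of _ "(1 / a, - b / a)"]) auto
qed (auto simp: algebra_simps)

lemma affine_group_inv [simp]:
  assumes "a \<noteq> 0"
  shows "inv\<^bsub>affine_group\<^esub> (a, b) = (1 / a, - b / a)"
proof -
  interpret group affine_group by (rule group_affine_group)
  show ?thesis using assms by (intro inv_equality) auto
qed

lemma affine_group_pow:
  "(a, 0) [^]\<^bsub>affine_group\<^esub> (k :: nat) = (a ^ k, 0)"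
  by (induction k) (auto simp: nat_pow_def algebra_simps)

text \<open>Induction on the set: a new fraction multiplies the integer found so far by its
  denominator.\<close>

lemma rat_common_denominator:
  fixes D :: "rat set"
  assumes "finite D"
  obtains N :: int where "N > 0" "\<And>d. d \<in> D \<Longrightarrow> of_int N * d \<in> \<int>"
proof -
  have "\<exists>N::int. N > 0 \<and> (\<forall>d\<in>D. of_int N * d \<in> \<int>)"
    using assms
  proof induction
    case empty
    show ?case by (intro exI[of _ 1]) auto
  next
    case (insert e D)
    then obtain N :: int where N: "N > 0" "\<forall>d\<in>D. of_int N * d \<in> \<int>" by auto
    obtain p q where e: "e = Fract p q" "q > 0" by (cases e) auto
    have "of_int (N * q) * e = of_int (N * p)"
      using e by (simp add: Fract_of_int_quotient)
    then have "of_int (N * q) * e \<in> \<int>" by (simp only: Ints_of_int)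
    moreover have "of_int (N * q) * d \<in> \<int>" if "d \<in> D" for d
    proof -
      have "of_int N * d \<in> \<int>" using N that by blast
      then have "of_int q * (of_int N * d) \<in> \<int>" by (rule Ints_mult[OF Ints_of_int])
      then show ?thesis by (simp add: mult_ac)
    qed
    ultimately show ?case using N e(2) by (intro exI[of _ "N * q"]) (simp only: zero_less_mult_iff, simp)
  qed
  then show ?thesis using that by blast
qed

lemma derived_VB_3_not_finitely_generated:
  assumes "finite S" "S \<subseteq> carrier (VB 3)"
  shows "generate (VB 3) S \<noteq> derived (VB 3) (carrier (VB 3))"
proof
  assume gen: "generate (VB 3) S = derived (VB 3) (carrier (VB 3))"
  interpret V: group "VB 3" by (rule group_VB)
  interpret Q: group affine_group by (rule group_affine_group)
  define f :: "vb_gen \<Rightarrow> rat \<times> rat" where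
    "f x = (case x of SigmaGen i \<Rightarrow> (1 / 2, 0) | RhoGen i \<Rightarrow> (- 1, 1))" for x
  have "f \<in> vb_gens 3 \<rightarrow> carrier affine_group"
    by (auto simp: f_def split: vb_gen.split)
  \<comment> \<open>All sigma generators share one image, and so do all rho generators, whose image
    is an involution. This makes both braid relations trivial and turns the mixed relation into the
    centrality of the identity.\<close>
  moreover have "eval_word affine_group f v = eval_word affine_group f w"
    if "(v, w) \<in> vb_rels 3" for v w
    using that by (auto simp: vb_rels_def sg_def rh_def f_def)
  ultimately obtain h where h: "h \<in> hom (VB 3) affine_group"
    and hf: "\<And>x. x \<in> vb_gens 3 \<Longrightarrow> h (presented_gen (vb_gens 3) (vb_rels 3) x) = f x"
    using presented_group_hom[OF group_affine_group] unfolding VB_def by metis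
  interpret h: group_hom "VB 3" affine_group h
    by unfold_locales (rule h)
  have fst_mult: "fst (h (x \<otimes>\<^bsub>VB 3\<^esub> y)) = fst (h x) * fst (h y)"
    if "x \<in> carrier (VB 3)" "y \<in> carrier (VB 3)" for x y
    using that by (cases "h x"; cases "h y") simp
  have fst_nz: "fst (h x) \<noteq> 0" if "x \<in> carrier (VB 3)" for x
    using h.hom_closed[OF that] by (cases "h x") simp
  have fst_inv: "fst (h (inv\<^bsub>VB 3\<^esub> x)) = 1 / fst (h x)" if "x \<in> carrier (VB 3)" for x
    using fst_nz[OF that] that by (cases "h x") simp
  have fst_commutator: "fst (h (x \<otimes>\<^bsub>VB 3\<^esub> y \<otimes>\<^bsub>VB 3\<^esub> inv\<^bsub>VB 3\<^esub> x \<otimes>\<^bsub>VB 3\<^esub> inv\<^bsub>VB 3\<^esub> y)) = 1"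
    if "x \<in> carrier (VB 3)" "y \<in> carrier (VB 3)" for x y
    using that fst_nz by (simp add: fst_mult fst_inv del: h.hom_mult h.hom_inv)
  \<comment> \<open>The linear part is multiplicative with commuting values, hence trivial on
    commutators.\<close>
  have derived_fst: "fst (h x) = 1" if "x \<in> derived (VB 3) (carrier (VB 3))" for x
    using that unfolding derived_def
  proof induction
    case (incl x)
    then show ?case using fst_commutator by blast
  next
    case (inv x)
    have "x \<in> carrier (VB 3)" using V.derived_set_in_carrier[OF subset_refl] inv by (rule subsetD)
    moreover have "fst (h x) = 1" using inv fst_commutator by blast
    ultimately
    show ?case by (simp add: fst_inv del: h.hom_inv)
  next
    case (eng x y)
    have "x \<in> carrier (VB 3)" "y \<in> carrier (VB 3)"
      using V.generate_in_carrier[OF V.derived_set_in_carrier[OF subset_refl]] eng(1,2) by blast+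
    then show ?case using eng.IH by (simp add: fst_mult del: h.hom_mult)
  qed simp
  obtain N :: int where N: "N > 0" "\<And>d. d \<in> (snd \<circ> h) ` S \<Longrightarrow> of_int N * d \<in> \<int>"
    using rat_common_denominator[of "(snd \<circ> h) ` S"] assms by blast
  have S1: "fst (h x) = 1" if "x \<in> S" for x
    using derived_fst that gen generate.incl[of x S "VB 3"] by auto
  \<comment> \<open>The linear part is carried through the induction because translation parts add
    only when it is 1.\<close>
  have int: "fst (h x) = 1 \<and> of_int N * snd (h x) \<in> \<int>" if "x \<in> generate (VB 3) S" for x
    using that
  proof induction
    case (incl x)
    then show ?case using S1 N by auto
  next
    case (inv x)
    then have "x \<in> carrier (VB 3)" "fst (h x) = 1" "of_int N * snd (h x) \<in> \<int>"
      using S1 N assms by auto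
    then show ?case by (cases "h x") auto
  next
    case (eng x y)
    then have "x \<in> carrier (VB 3)" "y \<in> carrier (VB 3)"
      using V.generate_in_carrier[OF assms(2)] by auto
    then show ?case using eng.IH by (cases "h x"; cases "h y") (auto simp: ring_distribs)
  qed simp
  \<comment> \<open>Any \<open>k\<close> with \<open>2 ^ k > N\<close> would serve; \<open>N\<close>
    itself is such an exponent.\<close>
  define k where "k = nat N"
  define s where "s = presented_gen (vb_gens 3) (vb_rels 3) (SigmaGen 1)"
  define r where "r = presented_gen (vb_gens 3) (vb_rels 3) (RhoGen 1)"
  define a where "a = s [^]\<^bsub>VB 3\<^esub> k"
  have s: "s \<in> carrier (VB 3)" and r: "r \<in> carrier (VB 3)"
    by (auto simp: s_def r_def VB_def vb_gens_def intro: presented_gen_closed)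
  then have a: "a \<in> carrier (VB 3)" by (simp add: a_def)
  have "SigmaGen 1 \<in> vb_gens 3" "RhoGen 1 \<in> vb_gens 3" by (auto simp: vb_gens_def)
  then have hs: "h s = (1 / 2, 0)" and hr: "h r = (- 1, 1)"
    by (simp_all only: hf s_def r_def) (simp_all add: f_def)
  have ha: "h a = ((1 / 2) ^ k, 0)"
    using s hs by (simp add: a_def h.hom_nat_pow affine_group_pow)
  let ?c = "a \<otimes>\<^bsub>VB 3\<^esub> r \<otimes>\<^bsub>VB 3\<^esub> inv\<^bsub>VB 3\<^esub> a \<otimes>\<^bsub>VB 3\<^esub> inv\<^bsub>VB 3\<^esub> r"
  have "?c \<in> derived (VB 3) (carrier (VB 3))"
    unfolding derived_def using a r by (intro generate.incl) blast
  then have "of_int N * snd (h ?c) \<in> \<int>" using int gen by auto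
  moreover have "snd (h ?c) = (1 / 2) ^ k - 1"
    using a r by (simp add: ha hr)
  \<comment> \<open>Adding \<open>of_int N\<close> cancels the \<open>- 1\<close>. Integrality of
    \<open>N / 2 ^ k\<close> then makes \<open>2 ^ k\<close> a divisor of the positive number
    \<open>N\<close>, against the choice of \<open>k\<close>.\<close>
  ultimately have "of_int N * ((1 / 2) ^ k - 1) + of_int N \<in> (\<int> :: rat set)"
    by (intro Ints_add) auto
  then have "of_int N * (1 / 2) ^ k \<in> (\<int> :: rat set)" by (simp add: right_diff_distrib)
  then obtain m :: int where "of_int N * (1 / 2) ^ k = (of_int m :: rat)" by (auto elim: Ints_cases)
  then have "(of_int N :: rat) = of_int (m * 2 ^ k)" by (simp add: field_simps power_divide)
  then have "N = m * 2 ^ k" by (simp only: of_int_eq_iff)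
  then have "2 ^ k \<le> N" using N by (intro zdvd_imp_le) auto
  moreover have "int k < 2 ^ k" using of_nat_less_two_power[of k] by simp
  ultimately show False using N by (simp add: k_def)
qed

section \<open>Derived subgroups and generators\<close>

context group
begin

lemma l_inv_cancel: "x \<in> carrier G \<Longrightarrow> y \<in> carrier G \<Longrightarrow> inv x \<otimes> (x \<otimes> y) = y"
  by (simp add: m_assoc[symmetric])

lemma r_inv_cancel: "x \<in> carrier G \<Longrightarrow> y \<in> carrier G \<Longrightarrow> x \<otimes> (inv x \<otimes> y) = y"
  by (simp add: m_assoc[symmetric])

lemmas group_word_simps = m_assoc inv_mult_group l_inv_cancel r_inv_cancel

lemma conj_mult:
  assumes "x \<in> carrier G" "a \<in> carrier G" "b \<in> carrier G"
  shows "x \<otimes> (a \<otimes> b) \<otimes> inv x = (x \<otimes> a \<otimes> inv x) \<otimes> (x \<otimes> b \<otimes> inv x)"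
  using assms by (simp add: group_word_simps)

lemma conj_inv:
  assumes "x \<in> carrier G" "a \<in> carrier G"
  shows "x \<otimes> inv a \<otimes> inv x = inv (x \<otimes> a \<otimes> inv x)"
  using assms by (simp add: group_word_simps)

lemma conj_eq_self:
  assumes "x \<in> carrier G" "a \<in> carrier G" "x \<otimes> a = a \<otimes> x"
  shows "x \<otimes> a \<otimes> inv x = a"
  using assms by (simp add: group_word_simps)

lemma commute_inv:
  assumes "x \<in> carrier G" "a \<in> carrier G" "x \<otimes> a = a \<otimes> x"
  shows "x \<otimes> inv a = inv a \<otimes> x"
proof -
  have "inv a \<otimes> (x \<otimes> a) \<otimes> inv a = inv a \<otimes> x" "inv a \<otimes> (a \<otimes> x) \<otimes> inv a = x \<otimes> inv a"
    using assms(1,2) by (simp_all add: group_word_simps)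
  then show ?thesis using assms(3) by metis
qed

lemma commute_mult:
  assumes "x \<in> carrier G" "a \<in> carrier G" "b \<in> carrier G"
    "x \<otimes> a = a \<otimes> x" "x \<otimes> b = b \<otimes> x"
  shows "x \<otimes> (a \<otimes> b) = (a \<otimes> b) \<otimes> x"
  using assms by (metis m_assoc)

lemma conj_generate:
  assumes X: "X \<subseteq> carrier G" and g: "g \<in> carrier G"
    and conj: "\<And>x. x \<in> X \<Longrightarrow> g \<otimes> x \<otimes> inv g \<in> generate G X"
    and h: "h \<in> generate G X"
  shows "g \<otimes> h \<otimes> inv g \<in> generate G X"
  using h
proof induction
  case one
  then show ?case using g generate.one by simp
next
  case (incl h)
  then show ?case by (rule conj)
next
  case (inv h)
  then have "g \<otimes> inv h \<otimes> inv g = inv (g \<otimes> h \<otimes> inv g)" using X g by (intro conj_inv) auto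
  then show ?case using generate_m_inv_closed[OF X conj[OF inv]] by simp
next
  case (eng h k)
  then have "g \<otimes> (h \<otimes> k) \<otimes> inv g = (g \<otimes> h \<otimes> inv g) \<otimes> (g \<otimes> k \<otimes> inv g)"
    using X g generate_in_carrier by (intro conj_mult) auto
  then show ?case using eng.IH generate.eng by metis
qed

text \<open>Conjugation by both \<open>y\<close> and \<open>inv y\<close> is tested, since an
  infinite subgroup can be mapped by a conjugation onto a proper part of itself.\<close>

lemma normal_generate_conj:
  assumes X: "X \<subseteq> carrier G" and Y: "Y \<subseteq> carrier G" and YG: "generate G Y = carrier G"
    and conj: "\<And>x y. x \<in> X \<Longrightarrow> y \<in> Y \<Longrightarrow> y \<otimes> x \<otimes> inv y \<in> generate G X"
    and conj': "\<And>x y. x \<in> X \<Longrightarrow> y \<in> Y \<Longrightarrow> inv y \<otimes> x \<otimes> y \<in> generate G X"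
  shows "generate G X \<lhd> G"
proof -
  have "\<forall>h\<in>generate G X. g \<otimes> h \<otimes> inv g \<in> generate G X" if "g \<in> generate G Y" for g
    using that
  proof induction
    case one
    show ?case using generate_in_carrier[OF X] by simp
  next
    case (incl y)
    then show ?case using Y conj by (auto intro: conj_generate[OF X])
  next
    case (inv y)
    then have "y \<in> carrier G" using Y by auto
    then show ?case using conj'[OF _ inv] conj_generate[OF X, of "inv y"] by auto
  next
    case (eng g k)
    have gk: "g \<in> carrier G" "k \<in> carrier G" using eng generate_in_carrier[OF Y] by auto
    show ?case
    proof
      fix h assume h: "h \<in> generate G X"
      then have "g \<otimes> (k \<otimes> h \<otimes> inv k) \<otimes> inv g \<in> generate G X" using eng.IH by blast
      then show "g \<otimes> k \<otimes> h \<otimes> inv (g \<otimes> k) \<in> generate G X"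
        using gk generate_in_carrier[OF X h] by (simp add: group_word_simps)
    qed
  qed
  then show ?thesis
    by (simp add: normal_inv_iff YG generate_is_subgroup X)
qed

text \<open>
  For a normal subgroup \<open>H\<close> and fixed \<open>x\<close>, the elements commuting with \<open>x\<close> modulo \<open>H\<close> form a
  subgroup; hence it suffices to test generators.
\<close>

lemma commutator_generate:
  assumes H: "H \<lhd> G" and Y: "Y \<subseteq> carrier G" and x: "x \<in> carrier G"
    and comm: "\<And>y. y \<in> Y \<Longrightarrow> x \<otimes> y \<otimes> inv x \<otimes> inv y \<in> H"
    and z: "z \<in> generate G Y"
  shows "x \<otimes> z \<otimes> inv x \<otimes> inv z \<in> H"
proof -
  interpret H: normal H G by (rule H)
  show ?thesis
    using z
  proof induction
    case one
    then show ?case using x by simp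
  next
    case (incl y)
    then show ?case by (rule comm)
  next
    case (inv y)
    then have y: "y \<in> carrier G" using Y by auto
    \<comment> \<open>With \<open>[x, y]\<close> for the commutator, \<open>[x, inv y]\<close> is
      the conjugate of \<open>inv [x, y]\<close> by \<open>inv y\<close>.\<close>
    have "inv y \<otimes> inv (x \<otimes> y \<otimes> inv x \<otimes> inv y) \<otimes> y \<in> H"
      using comm[OF inv] y H.inv_op_closed1 by simp
    then show ?case using x y by (simp add: group_word_simps)
  next
    case (eng y z)
    then have yz: "y \<in> carrier G" "z \<in> carrier G" using generate_in_carrier[OF Y] by auto
    \<comment> \<open>Here \<open>[x, y z]\<close> is the product of \<open>[x, y]\<close> and the
      conjugate of \<open>[x, z]\<close> by \<open>y\<close>.\<close>
    have "(x \<otimes> y \<otimes> inv x \<otimes> inv y) \<otimes> (y \<otimes> (x \<otimes> z \<otimes> inv x \<otimes> inv z) \<otimes> inv y) \<in> H"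
      using eng yz H.inv_op_closed2 by simp
    then show ?case using x yz by (simp add: group_word_simps)
  qed
qed

text \<open>\<open>commutator_generate\<close> extends the hypothesis one argument at a time;
  inverting a commutator exchanges its arguments in between.\<close>

lemma derived_subset_normal:
  assumes H: "H \<lhd> G" and Y: "Y \<subseteq> carrier G" and YG: "generate G Y = carrier G"
    and comm: "\<And>x y. x \<in> Y \<Longrightarrow> y \<in> Y \<Longrightarrow> x \<otimes> y \<otimes> inv x \<otimes> inv y \<in> H"
  shows "derived G (carrier G) \<subseteq> H"
proof -
  interpret H: normal H G by (rule H)
  have 1: "x \<otimes> y \<otimes> inv x \<otimes> inv y \<in> H" if "x \<in> Y" "y \<in> carrier G" for x y
    using that Y YG by (intro commutator_generate[OF H Y _ comm]) auto
  have "x \<otimes> y \<otimes> inv x \<otimes> inv y \<in> H" if "x \<in> carrier G" "y \<in> carrier G" for x y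
  proof (rule commutator_generate[OF H Y _ _, of x y])
    show "x \<otimes> z \<otimes> inv x \<otimes> inv z \<in> H" if z: "z \<in> Y" for z
    proof -
      have "inv (z \<otimes> x \<otimes> inv z \<otimes> inv x) \<in> H" using 1[OF z \<open>x \<in> carrier G\<close>] by simp
      then show ?thesis using z Y \<open>x \<in> carrier G\<close> by (simp add: group_word_simps subset_iff)
    qed
  qed (use that YG in auto)
  then show ?thesis
    unfolding derived_def by (intro generate_subgroup_incl H.is_subgroup) auto
qed

lemma commutator_in_derived:
  assumes "x \<in> carrier G" "y \<in> carrier G"
  shows "x \<otimes> y \<otimes> inv x \<otimes> inv y \<in> derived G (carrier G)"
  unfolding derived_def using assms by (intro generate.incl) blast

end

section \<open>The derived subgroup on at least four strands\<close>

text \<open>The relations are posed in an arbitrary group, so that calculations involve elements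
  rather than classes of words. Products are nested to the right, the normal form of
  \<open>m_assoc\<close>.\<close>

locale virtual_braid = group G for G (structure) +
  fixes n :: nat and s r :: "nat \<Rightarrow> 'a"
  assumes n: "n \<ge> 4"
    and s_closed [simp]: "i \<in> {1..n - 1} \<Longrightarrow> s i \<in> carrier G"
    and r_closed [simp]: "i \<in> {1..n - 1} \<Longrightarrow> r i \<in> carrier G"
    and generators: "generate G (s ` {1..n - 1} \<union> r ` {1..n - 1}) = carrier G"
    and s_s: "i \<in> {1..n - 1} \<Longrightarrow> j \<in> {1..n - 1} \<Longrightarrow> far i j \<Longrightarrow> s i \<otimes> s j = s j \<otimes> s i"
    and s_braid: "i \<in> {1..n - 2} \<Longrightarrow>
      s i \<otimes> (s (i + 1) \<otimes> s i) = s (i + 1) \<otimes> (s i \<otimes> s (i + 1))"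
    and r_r_self: "i \<in> {1..n - 1} \<Longrightarrow> r i \<otimes> r i = \<one>"
    and r_r: "i \<in> {1..n - 1} \<Longrightarrow> j \<in> {1..n - 1} \<Longrightarrow> far i j \<Longrightarrow> r i \<otimes> r j = r j \<otimes> r i"
    and r_braid: "i \<in> {1..n - 2} \<Longrightarrow>
      r i \<otimes> (r (i + 1) \<otimes> r i) = r (i + 1) \<otimes> (r i \<otimes> r (i + 1))"
    and s_r: "i \<in> {1..n - 1} \<Longrightarrow> j \<in> {1..n - 1} \<Longrightarrow> far i j \<Longrightarrow> s i \<otimes> r j = r j \<otimes> s i"
    and r_r_s: "i \<in> {1..n - 2} \<Longrightarrow>
      r i \<otimes> (r (i + 1) \<otimes> s i) = s (i + 1) \<otimes> (r i \<otimes> r (i + 1))"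
begin

section \<open>The generating set, and \<open>s 2\<close> and \<open>s 3\<close> as conjugates of
  \<open>s 1\<close>\<close>

definition v :: "nat \<Rightarrow> 'a" where "v j = r j \<otimes> r 1"
text \<open>Written as the commutator of \<open>inv (v 2)\<close> and \<open>s 1\<close>, which
  shows that it is in the derived subgroup; \<open>u_eq\<close> gives the short form.\<close>

definition u :: 'a where "u = inv (v 2) \<otimes> s 1 \<otimes> v 2 \<otimes> inv (s 1)"
definition p :: 'a where "p = s 1 \<otimes> u \<otimes> inv (s 1)"
definition c :: 'a where "c = s 1 \<otimes> r 1 \<otimes> inv (s 1) \<otimes> r 1"

definition X :: "'a set" where "X = v ` {2..n - 1} \<union> {u, p, c}"

lemma index_bounds [simp]: "Suc 0 \<le> n - Suc 0" "2 \<le> n - Suc 0" "3 \<le> n - Suc 0" "Suc 0 \<le> n - 2"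
  using n by auto

lemma index_le: "i \<in> {2..n - 1} \<Longrightarrow> i \<in> {1..n - 1}"
  by auto

lemma r_r_cancel [simp]:
  "i \<in> {1..n - 1} \<Longrightarrow> x \<in> carrier G \<Longrightarrow> r i \<otimes> (r i \<otimes> x) = x"
  by (simp add: m_assoc[symmetric] r_r_self)

lemma inv_r [simp]: "i \<in> {1..n - 1} \<Longrightarrow> inv (r i) = r i"
  by (intro inv_equality r_r_self r_closed)

lemma v_closed [simp]: "j \<in> {1..n - 1} \<Longrightarrow> v j \<in> carrier G"
  by (simp add: v_def)

lemma u_closed [simp]: "u \<in> carrier G"
  by (simp add: u_def)

lemma p_closed [simp]: "p \<in> carrier G"
  by (simp add: p_def)

lemma c_closed [simp]: "c \<in> carrier G"
  by (simp add: c_def)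

lemma X_closed: "X \<subseteq> carrier G"
  by (auto simp: X_def intro!: v_closed)

lemmas braid_simps = group_word_simps v_def r_r_self

text \<open>The mixed relation solved for \<open>s (i + 1)\<close>, using that each
  \<open>r i\<close> is an involution. Iterated, it expresses every \<open>s i\<close> through
  \<open>s 1\<close> and the rho generators.\<close>

lemma s_Suc:
  assumes "i \<in> {1..n - 2}"
  shows "s (i + 1) = r i \<otimes> (r (i + 1) \<otimes> (s i \<otimes> (r (i + 1) \<otimes> r i)))"
proof -
  have i: "i \<in> {1..n - 1}" "i + 1 \<in> {1..n - 1}" using assms by auto
  then have "s (i + 1) = s (i + 1) \<otimes> (r i \<otimes> r (i + 1)) \<otimes> (r (i + 1) \<otimes> r i)"
    by (simp add: braid_simps)
  also have "\<dots> = r i \<otimes> (r (i + 1) \<otimes> s i) \<otimes> (r (i + 1) \<otimes> r i)"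
    by (simp only: r_r_s[OF assms])
  finally show ?thesis using i by (simp add: braid_simps)
qed

lemma s_2: "s 2 = inv (v 2) \<otimes> s 1 \<otimes> v 2"
  using s_Suc[of 1] n by (simp add: braid_simps numeral_2_eq_2)

lemma u_eq: "u = s 2 \<otimes> inv (s 1)"
  by (simp add: u_def s_2)

text \<open>In rho generators this is \<open>r 2 r 1 r 3 r 2\<close>, which conjugates
  \<open>s 1\<close> to \<open>s 3\<close>; written through \<open>v\<close> it visibly lies in the
  subgroup generated by \<open>X\<close>.\<close>

definition w :: 'a where "w = v 2 \<otimes> v 3 \<otimes> inv (v 2)"

lemma w_closed [simp]: "w \<in> carrier G"
  by (simp add: w_def)

lemma s_3: "s 3 = w \<otimes> s 1 \<otimes> inv w"
proof -
  have "s 3 = r 2 \<otimes> (r 3 \<otimes> (s 2 \<otimes> (r 3 \<otimes> r 2)))"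
    using s_Suc[of 2] n by simp
  moreover have "r 3 \<otimes> (r 1 \<otimes> x) = r 1 \<otimes> (r 3 \<otimes> x)" if "x \<in> carrier G" for x
    using r_r[of 3 1] that by (simp add: m_assoc[symmetric])
  ultimately show ?thesis
    by (simp add: s_2 w_def braid_simps r_r[of 3 1])
qed

section \<open>Conjugation of the generators by \<open>s 1\<close> and its inverse\<close>

lemma conj_s_1_v_2: "s 1 \<otimes> v 2 \<otimes> inv (s 1) = v 2 \<otimes> u"
  by (simp add: u_def group_word_simps)

text \<open>For \<open>j \<ge> 3\<close> the involution \<open>r j\<close> commutes with
  \<open>s 1\<close> and \<open>r 1\<close>, hence with \<open>c\<close>; moving it past
  \<open>c\<close> and \<open>s 1\<close> gives the claim.\<close>

lemma conj_s_1_v: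
  assumes "j \<in> {3..n - 1}"
  shows "s 1 \<otimes> v j \<otimes> inv (s 1) = c \<otimes> v j"
proof -
  have j: "j \<in> {1..n - 1}" and far: "far 1 j" using assms by auto
  have "r j \<otimes> c = c \<otimes> r j"
    unfolding c_def using j far s_r[of 1 j] r_r[of 1 j]
    by (intro commute_mult commute_inv m_closed inv_closed) auto
  then have "c \<otimes> v j = r j \<otimes> c \<otimes> r 1" using j by (simp add: v_def m_assoc[symmetric])
  also have "\<dots> = r j \<otimes> s 1 \<otimes> r 1 \<otimes> inv (s 1)" using j by (simp add: c_def braid_simps)
  also have "\<dots> = s 1 \<otimes> v j \<otimes> inv (s 1)"
    using j s_r[OF _ j far] by (simp add: v_def m_assoc[symmetric])
  finally show ?thesis by simp
qed

definition y :: 'a where "y = s 3 \<otimes> inv (s 1)"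

lemma y_closed [simp]: "y \<in> carrier G"
  by (simp add: y_def)

lemma s_3_s_1: "s 3 \<otimes> s 1 = s 1 \<otimes> s 3"
  by (simp add: s_s)

lemma s_3_c: "s 3 \<otimes> c = c \<otimes> s 3"
  unfolding c_def using s_r[of 3 1]
  by (intro commute_mult commute_inv m_closed inv_closed s_3_s_1) auto

lemma s_1_eq: "s 1 = inv y \<otimes> s 3"
  by (simp add: y_def braid_simps)

lemma conj_s_1_c: "s 1 \<otimes> c \<otimes> inv (s 1) = inv y \<otimes> c \<otimes> y"
proof -
  have "s 1 \<otimes> c \<otimes> inv (s 1) = inv y \<otimes> (s 3 \<otimes> c \<otimes> inv (s 3)) \<otimes> y"
    by (subst (1 2) s_1_eq) (simp add: group_word_simps)
  then show ?thesis by (simp add: conj_eq_self[OF _ _ s_3_c])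
qed

text \<open>\<open>s 3\<close> also commutes with
  \<open>inv (s 1) \<otimes> c \<otimes> s 1\<close>, so a further conjugation by \<open>s 3\<close>
  changes nothing and completes \<open>inv (s 1)\<close> to \<open>y\<close>.\<close>

lemma conj_inv_s_1_c: "inv (s 1) \<otimes> c \<otimes> s 1 = y \<otimes> c \<otimes> inv y"
proof -
  have "s 3 \<otimes> (inv (s 1) \<otimes> c \<otimes> s 1) = (inv (s 1) \<otimes> c \<otimes> s 1) \<otimes> s 3"
    by (intro commute_mult commute_inv m_closed inv_closed s_3_s_1 s_3_c) auto
  then have "s 3 \<otimes> (inv (s 1) \<otimes> c \<otimes> s 1) \<otimes> inv (s 3) = inv (s 1) \<otimes> c \<otimes> s 1"
    by (intro conj_eq_self) auto
  then show ?thesis by (simp add: y_def group_word_simps)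
qed

text \<open>
  The braid relation reads \<open>p\<^sub>k = p\<^bsub>k-1\<^esub> p\<^bsub>k+1\<^esub>\<close> for \<open>p\<^sub>k = \<sigma>\<^sub>1\<^sup>k u \<sigma>\<^sub>1\<^sup>-\<^sup>k\<close>, so that \<open>u = p\<^sub>0\<close> and
  \<open>p = p\<^sub>1\<close> generate all \<open>p\<^sub>k\<close>.
\<close>

lemma conj_s_1_p: "s 1 \<otimes> p \<otimes> inv (s 1) = inv u \<otimes> p"
proof -
  have "s 1 \<otimes> (s 2 \<otimes> s 1) = s 2 \<otimes> (s 1 \<otimes> s 2)" using s_braid[of 1] by (simp flip: numeral_2_eq_2)
  then have "inv (s 2) \<otimes> (s 1 \<otimes> (s 2 \<otimes> s 1)) \<otimes> inv (s 1) =
      inv (s 2) \<otimes> (s 2 \<otimes> (s 1 \<otimes> s 2)) \<otimes> inv (s 1)" by simp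
  then have *: "s 1 \<otimes> (s 2 \<otimes> inv (s 1)) = inv (s 2) \<otimes> (s 1 \<otimes> s 2)" by (simp add: group_word_simps)
  have "s 1 \<otimes> p \<otimes> inv (s 1) = s 1 \<otimes> (s 1 \<otimes> (s 2 \<otimes> inv (s 1))) \<otimes> inv (s 1) \<otimes> inv (s 1)"
    by (simp add: p_def u_eq group_word_simps)
  also have "\<dots> = s 1 \<otimes> (inv (s 2) \<otimes> (s 1 \<otimes> s 2)) \<otimes> inv (s 1) \<otimes> inv (s 1)"
    by (simp only: * )
  also have "\<dots> = inv u \<otimes> p" by (simp add: p_def u_eq group_word_simps)
  finally show ?thesis .
qed

text \<open>The recursion at \<open>k = 0\<close>, obtained by conjugating its case
  \<open>k = 1\<close> with \<open>inv (s 1)\<close>.\<close>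

lemma conj_inv_s_1_u: "inv (s 1) \<otimes> u \<otimes> s 1 = u \<otimes> inv p"
proof -
  have "p = u \<otimes> (s 1 \<otimes> p \<otimes> inv (s 1))" by (simp only: conj_s_1_p) (simp add: group_word_simps)
  then have "inv (s 1) \<otimes> p \<otimes> s 1 = inv (s 1) \<otimes> (u \<otimes> (s 1 \<otimes> p \<otimes> inv (s 1))) \<otimes> s 1" by simp
  then have "u = (inv (s 1) \<otimes> u \<otimes> s 1) \<otimes> p" by (simp add: p_def group_word_simps)
  then show ?thesis by (simp add: inv_solve_right)
qed

text \<open>Conjugate \<open>conj_s_1_v_2\<close> back by \<open>inv (s 1)\<close> and solve for the
  conjugate of \<open>v 2\<close>.\<close>

lemma conj_inv_s_1_v_2: "inv (s 1) \<otimes> v 2 \<otimes> s 1 = v 2 \<otimes> p \<otimes> inv u"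
proof -
  have "inv (s 1) \<otimes> (v 2 \<otimes> u) \<otimes> s 1 = v 2"
    unfolding conj_s_1_v_2[symmetric] by (simp add: group_word_simps)
  moreover have "inv (s 1) \<otimes> (v 2 \<otimes> u) \<otimes> s 1 =
      (inv (s 1) \<otimes> v 2 \<otimes> s 1) \<otimes> (inv (s 1) \<otimes> u \<otimes> s 1)"
    by (simp add: group_word_simps)
  ultimately have "(inv (s 1) \<otimes> v 2 \<otimes> s 1) \<otimes> (u \<otimes> inv p) = v 2"
    by (simp only: conj_inv_s_1_u)
  then have "inv (s 1) \<otimes> v 2 \<otimes> s 1 = v 2 \<otimes> inv (u \<otimes> inv p)"
    by (intro inv_solve_right[THEN iffD2]) auto
  then show ?thesis by (simp add: group_word_simps)
qed

lemma conj_inv_s_1_v: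
  assumes "j \<in> {3..n - 1}"
  shows "inv (s 1) \<otimes> v j \<otimes> s 1 = inv (inv (s 1) \<otimes> c \<otimes> s 1) \<otimes> v j"
proof -
  have j: "j \<in> {1..n - 1}" using assms by auto
  have "inv (s 1) \<otimes> (s 1 \<otimes> v j \<otimes> inv (s 1)) \<otimes> s 1 = inv (s 1) \<otimes> (c \<otimes> v j) \<otimes> s 1"
    by (simp only: conj_s_1_v[OF assms])
  then have "v j = (inv (s 1) \<otimes> c \<otimes> s 1) \<otimes> (inv (s 1) \<otimes> v j \<otimes> s 1)"
    using j by (simp add: group_word_simps)
  then show ?thesis using j by (subst inv_solve_left) auto
qed

section \<open>Conjugation of the generators by \<open>r 1\<close>\<close>

lemma conj_r_1_v: "j \<in> {1..n - 1} \<Longrightarrow> r 1 \<otimes> v j \<otimes> inv (r 1) = inv (v j)"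
  by (simp add: braid_simps)

lemma conj_r_1_c: "r 1 \<otimes> c \<otimes> inv (r 1) = inv c"
  by (simp add: braid_simps c_def)

text \<open>Conjugation by \<open>r 1\<close> inverts \<open>v 2\<close> and sends
  \<open>s 1\<close> to \<open>inv c \<otimes> s 1\<close>; substitute both into the definition of
  \<open>u\<close>.\<close>

lemma conj_r_1_u: "r 1 \<otimes> u \<otimes> inv (r 1) = v 2 \<otimes> inv c \<otimes> inv (s 1 \<otimes> v 2 \<otimes> inv (s 1)) \<otimes> c"
  by (simp add: braid_simps c_def u_def)

lemma conj_r_1_p: "r 1 \<otimes> p \<otimes> inv (r 1) =
    inv c \<otimes> (s 1 \<otimes> (r 1 \<otimes> u \<otimes> inv (r 1)) \<otimes> inv (s 1)) \<otimes> c"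
  by (simp add: braid_simps c_def p_def)

section \<open>Normality of \<open>H\<close>\<close>

abbreviation H :: "'a set" where "H \<equiv> generate G X"

lemma H_mult: "a \<in> H \<Longrightarrow> b \<in> H \<Longrightarrow> a \<otimes> b \<in> H"
  by (rule generate.eng)

lemma H_inv: "a \<in> H \<Longrightarrow> inv a \<in> H"
  by (rule generate_m_inv_closed[OF X_closed])

lemma v_in_H: "j \<in> {2..n - 1} \<Longrightarrow> v j \<in> H"
  and u_in_H: "u \<in> H" and p_in_H: "p \<in> H" and c_in_H: "c \<in> H"
  by (auto simp: X_def intro: generate.incl)

lemma v_2_in_H: "v 2 \<in> H" and v_3_in_H: "v 3 \<in> H"
  using v_in_H n by auto

lemmas H_intros = H_mult H_inv v_in_H u_in_H p_in_H c_in_H v_2_in_H v_3_in_H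

text \<open>By \<open>s_3\<close>, \<open>y\<close> is \<open>w\<close> times the inverse of the
  \<open>s 1\<close>-conjugate of \<open>w\<close>. As \<open>w\<close> is a word in
  \<open>v 2\<close> and \<open>v 3\<close>, only their conjugates are required; that of
  \<open>c\<close>, which involves \<open>y\<close>, is not, so there is no circularity.\<close>

lemma y_in_H: "y \<in> H"
proof -
  have v_3: "s 1 \<otimes> v 3 \<otimes> inv (s 1) = c \<otimes> v 3"
    by (rule conj_s_1_v) simp
  have "s 1 \<otimes> w \<otimes> inv (s 1) =
      (s 1 \<otimes> v 2 \<otimes> inv (s 1)) \<otimes> (s 1 \<otimes> v 3 \<otimes> inv (s 1)) \<otimes> inv (s 1 \<otimes> v 2 \<otimes> inv (s 1))"
    by (simp add: w_def group_word_simps)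
  also have "\<dots> = v 2 \<otimes> u \<otimes> (c \<otimes> v 3) \<otimes> inv (v 2 \<otimes> u)"
    by (simp only: conj_s_1_v_2 v_3)
  also have "\<dots> \<in> H" by (intro H_intros)
  finally have "inv (s 1 \<otimes> w \<otimes> inv (s 1)) \<in> H" by (rule H_inv)
  moreover have "w \<in> H" unfolding w_def by (intro H_mult H_inv v_2_in_H v_3_in_H)
  ultimately have "w \<otimes> inv (s 1 \<otimes> w \<otimes> inv (s 1)) \<in> H" by (intro H_mult)
  then show ?thesis by (simp add: y_def s_3 group_word_simps)
qed

lemma X_cases:
  assumes "x \<in> X"
  obtains "x = v 2" | j where "j \<in> {3..n - 1}" "x = v j" | "x = u" | "x = p" | "x = c"
proof -
  have "{2..n - 1} = insert 2 {3..n - 1}" using n by auto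
  then show ?thesis using assms that by (auto simp: X_def)
qed

lemma conj_s_1_X:
  assumes "x \<in> X"
  shows "s 1 \<otimes> x \<otimes> inv (s 1) \<in> H"
  using assms
proof (cases rule: X_cases)
  case 1
  then show ?thesis unfolding 1 conj_s_1_v_2 by (intro H_intros)
next
  case 2
  then show ?thesis unfolding 2(2) conj_s_1_v[OF 2(1)] by (intro H_intros) auto
next
  case 3
  then show ?thesis using p_in_H by (simp add: p_def)
next
  case 4
  then show ?thesis unfolding 4 conj_s_1_p by (intro H_intros)
next
  case 5
  then show ?thesis unfolding 5 conj_s_1_c by (intro H_intros y_in_H)
qed

lemma conj_inv_s_1_X:
  assumes "x \<in> X"
  shows "inv (s 1) \<otimes> x \<otimes> s 1 \<in> H"
  using assms
proof (cases rule: X_cases)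
  case 1
  then show ?thesis unfolding 1 conj_inv_s_1_v_2 by (intro H_intros)
next
  case 2
  then show ?thesis unfolding 2(2) conj_inv_s_1_v[OF 2(1)] conj_inv_s_1_c
    by (intro H_intros y_in_H) auto
next
  case 3
  then show ?thesis unfolding 3 conj_inv_s_1_u by (intro H_intros)
next
  case 4
  then show ?thesis using u_in_H by (simp add: p_def group_word_simps)
next
  case 5
  then show ?thesis unfolding 5 conj_inv_s_1_c by (intro H_intros y_in_H)
qed

lemma conj_r_1_X:
  assumes "x \<in> X"
  shows "r 1 \<otimes> x \<otimes> inv (r 1) \<in> H"
proof -
  have *: "r 1 \<otimes> u \<otimes> inv (r 1) \<in> H"
    unfolding conj_r_1_u conj_s_1_v_2 by (intro H_intros)
  consider j where "j \<in> {2..n - 1}" "x = v j" | "x = u" | "x = p" | "x = c"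
    using assms by (force simp: X_def)
  then show ?thesis
  proof cases
    case 1
    then show ?thesis unfolding 1(2) conj_r_1_v[OF index_le[OF 1(1)]] by (intro H_intros)
  next
    case 2
    then show ?thesis using * by simp
  next
    case 3
    \<comment> \<open>The inner conjugate of \<open>u\<close> is in \<open>H\<close> by
      \<open>*\<close>, and conjugation by \<open>s 1\<close> preserves \<open>H\<close> because it
      does so on \<open>X\<close>.\<close>
    then show ?thesis unfolding 3 conj_r_1_p
      by (intro H_intros conj_generate[OF X_closed _ conj_s_1_X *]) auto
  next
    case 4
    then show ?thesis unfolding 4 conj_r_1_c by (intro H_intros)
  qed
qed

text \<open>Generators of the whole group chosen so that all but \<open>s 1\<close> and
  \<open>r 1\<close> lie in \<open>H\<close>; only these two call for computation.\<close>

definition Y :: "'a set" where "Y = {s 1, r 1} \<union> v ` {2..n - 1}"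

lemma Y_closed: "Y \<subseteq> carrier G"
  by (auto simp: Y_def intro!: v_closed)

lemma generate_Y: "generate G Y = carrier G"
proof -
  let ?K = "generate G Y"
  have r1: "r 1 \<in> ?K" by (auto simp: Y_def intro: generate.incl)
  have r: "r i \<in> ?K" if "i \<in> {1..n - 1}" for i
  proof (cases "i = 1")
    case True
    then show ?thesis using r1 by simp
  next
    case False
    then have "v i \<in> ?K" using that by (auto simp: Y_def intro!: generate.incl)
    then have "v i \<otimes> r 1 \<in> ?K" using r1 by (rule generate.eng)
    then show ?thesis using that by (simp add: braid_simps)
  qed
  have s: "i \<ge> 1 \<Longrightarrow> i \<le> n - 1 \<Longrightarrow> s i \<in> ?K" for i
  proof (induction i rule: nat_induct_at_least)
    case base
    show ?case by (auto simp: Y_def intro: generate.incl)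
  next
    case (Suc i)
    then show ?case using s_Suc[of i] r[of i] r[of "Suc i"]
      by (auto intro!: generate.eng)
  qed
  have "carrier G \<subseteq> ?K"
    unfolding generators[symmetric]
    by (intro generate_subgroup_incl generate_is_subgroup Y_closed) (use r s in auto)
  then show ?thesis using generate_incl[OF Y_closed] by blast
qed

lemma normal_H: "H \<lhd> G"
proof (rule normal_generate_conj[OF X_closed Y_closed generate_Y])
  fix x y assume x: "x \<in> X" and y: "y \<in> Y"
  have xH: "x \<in> H" using x by (rule generate.incl)
  consider "y = s 1" | "y = r 1" | j where "j \<in> {2..n - 1}" "y = v j"
    using y by (auto simp: Y_def)
  note yc = this
  show "y \<otimes> x \<otimes> inv y \<in> H"
    using yc
  proof cases
    case 1 then show ?thesis using conj_s_1_X[OF x] by simp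
  next
    case 2 then show ?thesis using conj_r_1_X[OF x] by simp
  next
    case 3 then show ?thesis by (auto intro!: H_intros xH)
  qed
  show "inv y \<otimes> x \<otimes> y \<in> H"
    using yc
  proof cases
    case 1 then show ?thesis using conj_inv_s_1_X[OF x] by simp
  next
    \<comment> \<open>\<open>r 1\<close> is its own inverse, so the formula for \<open>r 1\<close>
      covers this case too.\<close>
    case 2 then show ?thesis using conj_r_1_X[OF x] by simp
  next
    case 3 then show ?thesis by (auto intro!: H_intros xH)
  qed
qed

section \<open>\<open>H\<close> as the derived subgroup\<close>

lemma derived_subset_H: "derived G (carrier G) \<subseteq> H"
proof (rule derived_subset_normal[OF normal_H Y_closed generate_Y])
  interpret H: normal H G by (rule normal_H)
  have left: "x \<otimes> y \<otimes> inv x \<otimes> inv y \<in> H" if "x \<in> H" "y \<in> carrier G" for x y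
  proof -
    have "x \<otimes> (y \<otimes> inv x \<otimes> inv y) \<in> H" using that by (intro H_mult H.inv_op_closed2 H_inv)
    then show ?thesis using that H.subset by (simp add: m_assoc subset_iff)
  qed
  have swap: "y \<otimes> x \<otimes> inv y \<otimes> inv x \<in> H"
    if "x \<otimes> y \<otimes> inv x \<otimes> inv y \<in> H" "x \<in> carrier G" "y \<in> carrier G" for x y
    using H_inv[OF that(1)] that(2,3) by (simp add: group_word_simps)
  have self: "x \<otimes> x \<otimes> inv x \<otimes> inv x \<in> H" if "x \<in> carrier G" for x
    using that generate.one by (simp add: group_word_simps)
  have sr: "s 1 \<otimes> r 1 \<otimes> inv (s 1) \<otimes> inv (r 1) \<in> H"
    using c_in_H by (simp add: c_def)
  fix x y assume x: "x \<in> Y" and y: "y \<in> Y"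
  then have closed: "x \<in> carrier G" "y \<in> carrier G" using Y_closed by auto
  \<comment> \<open>A commutator with an entry in \<open>H\<close> lies in \<open>H\<close> by
    normality; otherwise it is trivial, \<open>c\<close> or \<open>inv c\<close>.\<close>
  consider "x \<in> H" | "y \<in> H" | "x \<in> {s 1, r 1}" "y \<in> {s 1, r 1}"
    using x y v_in_H by (auto simp: Y_def)
  then show "x \<otimes> y \<otimes> inv x \<otimes> inv y \<in> H"
  proof cases
    case 1 then show ?thesis using left closed by blast
  next
    case 2 then show ?thesis using swap left closed by blast
  next
    case 3 then show ?thesis using self sr swap[OF sr] closed by auto
  qed
qed

lemma X_derived: "X \<subseteq> derived G (carrier G)"
proof -
  let ?D = "derived G (carrier G)"
  interpret D: normal ?D G by (rule derived_self_is_normal)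
  \<comment> \<open>The induction starts at \<open>v 1 = \<one>\<close>. The factor
    \<open>r (Suc j) \<otimes> r j\<close> from \<open>v j\<close> to \<open>v (Suc j)\<close> is a
    commutator by the braid relation for involutions.\<close>
  have "j \<ge> 1 \<Longrightarrow> j \<le> n - 1 \<Longrightarrow> v j \<in> ?D" for j
  proof (induction j rule: nat_induct_at_least)
    case base
    show ?case using D.one_closed by (simp add: braid_simps)
  next
    case (Suc j)
    then have j: "j \<in> {1..n - 2}" "j \<in> {1..n - 1}" "Suc j \<in> {1..n - 1}" by auto
    have "r (Suc j) \<otimes> r j = r j \<otimes> r (Suc j) \<otimes> inv (r j) \<otimes> inv (r (Suc j))"
    proof -
      have "r (Suc j) \<otimes> r j = (r (Suc j) \<otimes> (r j \<otimes> r (Suc j))) \<otimes> r (Suc j)"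
        using j by (simp add: braid_simps)
      also have "\<dots> = (r j \<otimes> (r (Suc j) \<otimes> r j)) \<otimes> r (Suc j)"
        using r_braid[OF j(1)] by simp
      finally show ?thesis using j by (simp add: braid_simps)
    qed
    then have "r (Suc j) \<otimes> r j \<in> ?D"
      using commutator_in_derived[OF r_closed[OF j(2)] r_closed[OF j(3)]] by (simp only:)
    then have "(r (Suc j) \<otimes> r j) \<otimes> v j \<in> ?D" using Suc by simp
    then show ?case using j by (simp add: braid_simps)
  qed
  then have v: "v j \<in> ?D" if "j \<in> {2..n - 1}" for j using that by auto
  have "inv (v 2) \<otimes> s 1 \<otimes> inv (inv (v 2)) \<otimes> inv (s 1) \<in> ?D"
    by (rule commutator_in_derived) auto
  then have u: "u \<in> ?D" by (simp add: u_def)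
  then have "p \<in> ?D" using D.inv_op_closed2 by (simp add: p_def)
  moreover have "c \<in> ?D" using commutator_in_derived[of "s 1" "r 1"] by (simp add: c_def)
  ultimately show ?thesis using u v by (auto simp: X_def)
qed

theorem derived_eq_H: "derived G (carrier G) = H"
  using derived_subset_H generate_subgroup_incl[OF X_derived derived_is_subgroup] by blast

end

section \<open>\<open>VB n\<close> as an instance of the locale\<close>

lemma virtual_braid_VB:
  assumes n: "n \<ge> 4"
  shows "virtual_braid (VB n) n (\<lambda>i. presented_gen (vb_gens n) (vb_rels n) (SigmaGen i))
    (\<lambda>i. presented_gen (vb_gens n) (vb_rels n) (RhoGen i))"
proof -
  interpret group "VB n" by (rule group_VB)
  let ?X = "vb_gens n" and ?R = "vb_rels n"
  let ?s = "\<lambda>i. presented_gen ?X ?R (SigmaGen i)" and ?r = "\<lambda>i. presented_gen ?X ?R (RhoGen i)"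
  have gens: "SigmaGen i \<in> ?X" "RhoGen i \<in> ?X" if "i \<in> {1..n - 1}" for i
    using that by (auto simp: vb_gens_def)
  have rel: "pres_cong ?X ?R `` {v} = pres_cong ?X ?R `` {w}" if "(v, w) \<in> ?R" for v w
  proof (rule equiv_class_eq[OF equiv_pres_cong])
    show "(v, w) \<in> pres_cong ?X ?R"
      using pres_cong.rel[of "[]" ?X "[]" v w ?R] vb_rels_words[of n] that by auto
  qed
  have mult: "pres_cong ?X ?R `` {a} \<otimes>\<^bsub>VB n\<^esub> pres_cong ?X ?R `` {b} = pres_cong ?X ?R `` {a @ b}"
    if "a \<in> words ?X" "b \<in> words ?X" for a b
    using that by (simp only: VB_def presented_group_mult)
  have s: "?s i = pres_cong ?X ?R `` {sg i}" and r: "?r i = pres_cong ?X ?R `` {rh i}" for i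
    by (simp_all add: presented_gen_def sg_def rh_def)
  have words: "sg i \<in> words ?X" "rh i \<in> words ?X" if "i \<in> {1..n - 1}" for i
    using gens[OF that] by (simp_all add: sg_def rh_def)
  have image: "presented_gen ?X ?R ` ?X = ?s ` {1..n - 1} \<union> ?r ` {1..n - 1}"
    by (simp add: vb_gens_def image_Un image_image)
  have "\<one>\<^bsub>VB n\<^esub> = pres_cong ?X ?R `` {[]}" by (simp only: VB_def presented_group_one)
  \<comment> \<open>These rules merge products of generators into the class of one word, so each
    locale axiom becomes a defining relation, settled by \<open>rel\<close>.\<close>
  note red = s r mult words append_in_lists_conv simp_thms this
  have Suc: "i \<in> {1..n - 1}" "i + 1 \<in> {1..n - 1}" if "i \<in> {1..n - 2}" for i
    using that by auto
  show ?thesis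
  proof
    show "4 \<le> n" by (rule n)
    show "?s i \<in> carrier (VB n)" "?r i \<in> carrier (VB n)" if "i \<in> {1..n - 1}" for i
      using gens[OF that] by (simp_all add: VB_def presented_gen_closed)
    show "generate (VB n) (?s ` {1..n - 1} \<union> ?r ` {1..n - 1}) = carrier (VB n)"
      using presented_group_generate[of ?X ?R] unfolding image VB_def .
  next
    fix i j assume ij: "i \<in> {1..n - 1}" "j \<in> {1..n - 1}" "far i j"
    show "?s i \<otimes>\<^bsub>VB n\<^esub> ?s j = ?s j \<otimes>\<^bsub>VB n\<^esub> ?s i"
      by (simp only: red ij) (intro rel, use ij in \<open>auto simp: vb_rels_def\<close>)
    show "?r i \<otimes>\<^bsub>VB n\<^esub> ?r j = ?r j \<otimes>\<^bsub>VB n\<^esub> ?r i"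
      by (simp only: red ij) (intro rel, use ij in \<open>auto simp: vb_rels_def\<close>)
    show "?s i \<otimes>\<^bsub>VB n\<^esub> ?r j = ?r j \<otimes>\<^bsub>VB n\<^esub> ?s i"
      by (simp only: red ij) (intro rel, use ij in \<open>auto simp: vb_rels_def\<close>)
  next
    fix i assume i: "i \<in> {1..n - 2}"
    note red = red Suc[OF i]
    show "?s i \<otimes>\<^bsub>VB n\<^esub> (?s (i + 1) \<otimes>\<^bsub>VB n\<^esub> ?s i) = ?s (i + 1) \<otimes>\<^bsub>VB n\<^esub> (?s i \<otimes>\<^bsub>VB n\<^esub> ?s (i + 1))"
      by (simp only: red) (intro rel, use i in \<open>auto simp: vb_rels_def\<close>)
    show "?r i \<otimes>\<^bsub>VB n\<^esub> (?r (i + 1) \<otimes>\<^bsub>VB n\<^esub> ?r i) = ?r (i + 1) \<otimes>\<^bsub>VB n\<^esub> (?r i \<otimes>\<^bsub>VB n\<^esub> ?r (i + 1))"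
      by (simp only: red) (intro rel, use i in \<open>auto simp: vb_rels_def\<close>)
    show "?r i \<otimes>\<^bsub>VB n\<^esub> (?r (i + 1) \<otimes>\<^bsub>VB n\<^esub> ?s i) = ?s (i + 1) \<otimes>\<^bsub>VB n\<^esub> (?r i \<otimes>\<^bsub>VB n\<^esub> ?r (i + 1))"
      by (simp only: red) (intro rel, use i in \<open>auto simp: vb_rels_def\<close>)
  next
    fix i assume i: "i \<in> {1..n - 1}"
    show "?r i \<otimes>\<^bsub>VB n\<^esub> ?r i = \<one>\<^bsub>VB n\<^esub>"
      by (simp only: red i) (intro rel, use i in \<open>auto simp: vb_rels_def\<close>)
  qed
qed

theorem theorem1p1:
  shows "\<not> (\<exists>S. finite S \<and> S \<subseteq> carrier (VB 3) \<and>
            generate (VB 3) S = derived (VB 3) (carrier (VB 3)))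
       \<and> (\<forall>n\<ge>4. \<exists>gs. length gs = 2 * n - 3 \<and> set gs \<subseteq> carrier (VB n) \<and>
            generate (VB n) (set gs) = derived (VB n) (carrier (VB n)))"
proof (intro conjI allI impI)
  show "\<not> (\<exists>S. finite S \<and> S \<subseteq> carrier (VB 3) \<and>
      generate (VB 3) S = derived (VB 3) (carrier (VB 3)))"
    using derived_VB_3_not_finitely_generated by blast
  fix n :: nat assume n: "n \<ge> 4"
  interpret virtual_braid "VB n" n "\<lambda>i. presented_gen (vb_gens n) (vb_rels n) (SigmaGen i)"
    "\<lambda>i. presented_gen (vb_gens n) (vb_rels n) (RhoGen i)"
    by (rule virtual_braid_VB[OF n])
  \<comment> \<open>Repetitions of \<open>c\<close> pad the \<open>n + 1\<close> generators to the required length.\<close>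
  define gs where "gs = map v [2..<n] @ [u, p] @ replicate (n - 3) c"
  have "length gs = 2 * n - 3" using n by (simp add: gs_def)
  moreover have "set gs = X"
  proof -
    have "{2..<n} = {2..n - 1}" using n by auto
    then show ?thesis using n by (auto simp: gs_def X_def)
  qed
  ultimately show "\<exists>gs. length gs = 2 * n - 3 \<and> set gs \<subseteq> carrier (VB n) \<and>
      generate (VB n) (set gs) = derived (VB n) (carrier (VB n))"
    using X_closed derived_eq_H by metis
qed

end
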